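(* Let $\{X_n:n<\omega\}$ be the uniformly c.e. family of sets (with their fixed uniform computable enumerations) described in the context, and for each $n$ let $\mathcal{A}_n=(\omega,<)$ and $\mathcal{B}_n=(\omega,<_{X_n})$. Let $\mathcal{M}$ and $\mathcal{N}$ be the computably composite structures built from $\{\mathcal{A}_n\}$ and $\{\mathcal{B}_n\}$ as in the context. Then $\mathrm{IsoSpec}(\mathcal{M},\mathcal{N})$ is not finitely generated.
   Context: For a c.e. set $X$ with fixed computable enumeration $\{x_i:i<\omega\}$, $(\omega,<_X)$ is the computable linear order on $\omega$ in which, for all $n<m$, $2n<_X2m$ and $2x_n<_X2n+1<_X2x_n+2$; it is a computable copy of $(\omega,<)$, and the unique isomorphism $(\omega,<)\cong(\omega,<_X)$ has the Turing degree of $X$. $\{X_n:n<\omega\}$ is a uniformly c.e. family (Thomason) such that, writing $X_F=\bigoplus_{m\in F}X_m$ and $\mathbf{d}_F=\deg_T(X_F)$ for finite $F\subseteq\omega$: $\mathbf{d}_F\le\mathbf{d}_G$ iff $F\subseteq G$, $\mathbf{d}_F\oplus\mathbf{d}_G=\mathbf{d}_{F\cup G}$, and $\mathbf{d}_F\wedge\mathbf{d}_G$ exists and equals $\mathbf{d}_{F\cap G}$. $\mathrm{IsoSpec}(\mathcal{A},\mathcal{B})$ is the set of degrees computing an isomorphism $\mathcal{A}\cong\mathcal{B}$; an upward-closed set of degrees is finitely generated if it is a finite union of cones. Construction: $\mathcal{H}$ has universe $H=[\omega]^{<\omega}\cup(\omega\times\{0,1\})$ and binary relations $E_i$ ($E_i(X,Y)$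 iff $X,Y$ finite sets with $X\triangle Y=\{i\}$) and $D_i$ ($D_i(X,(i,a))$ iff $X$ finite and $X(i)=a$). For a computable $\mathcal{S}$ with universe $S$ and uniformly computable $\{\mathcal{C}_x:x\in S\}$ with pairwise disjoint universes disjoint from $S$, $\mathcal{S}[\{\mathcal{C}_x\}]$ has universe $S\cup\bigcup_xC_x$, a new binary relation $\mu=\{(c,x):c\in C_x\}\cup\{(x,x):x\in S\}$, the relations of $\mathcal{S}$ on $S$ and of each $\mathcal{C}_x$ on $C_x$, and nothing else. Set $\mathcal{M}_{(i,0)}=\mathcal{N}_{(i,0)}=\{(i,0)\}\times\mathcal{A}_{i+1}$, $\mathcal{M}_{(i,1)}=\mathcal{N}_{(i,1)}=\{(i,1)\}\times\mathcal{B}_{i+1}$, and for finite $X$: $\mathcal{M}_X=\{X\}\times\mathcal{A}_0$, $\mathcal{N}_X=\{X\}\times\mathcal{B}_0$ if $|X|$ even, and $\mathcal{M}_X=\{X\}\times\mathcal{B}_0$, $\mathcal{N}_X=\{X\}\times\mathcal{A}_0$ if $|X|$ odd; $\mathcal{M}=\mathcal{H}[\{\mathcal{M}_z\}]$, $\mathcal{N}=\mathcal{H}[\{\mathcal{N}_z\}]$. *)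

theory Defs
  imports Main "HOL-Library.Nat_Bijection"
begin

section \<open>Oracle computability\<close>

text \<open>
  Kleene's recursive functions relative to an oracle \<open>Z\<close>, as codes with a big-step semantics:
  \<open>rec_eval Z p xs y\<close> means that the partial \<open>Z\<close>-recursive function with code \<open>p\<close>
  converges on the arguments \<open>xs\<close> with value \<open>y\<close>. Divergence is the absence of such a \<open>y\<close>.
\<close>

datatype prec =
    Zero | Succ | Proj nat | Oracle
  | Comp prec "prec list" | PrimRec prec prec | Mu prec

inductive rec_eval :: "nat set \<Rightarrow> prec \<Rightarrow> nat list \<Rightarrow> nat \<Rightarrow> bool" for Z :: "nat set" where
  zero: "rec_eval Z Zero xs 0"
| succ: "rec_eval Z Succ [x] (Suc x)"
| proj: "i < length xs \<Longrightarrow> rec_eval Z (Proj i) xs (xs ! i)"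
| query: "rec_eval Z Oracle [x] (of_bool (x \<in> Z))"
| comp: "list_all2 (\<lambda>g y. rec_eval Z g xs y) gs ys \<Longrightarrow> rec_eval Z f ys z
    \<Longrightarrow> rec_eval Z (Comp f gs) xs z"
| prec_0: "rec_eval Z f xs y \<Longrightarrow> rec_eval Z (PrimRec f g) (0 # xs) y"
| prec_Suc: "rec_eval Z (PrimRec f g) (n # xs) r \<Longrightarrow> rec_eval Z g (n # r # xs) y
    \<Longrightarrow> rec_eval Z (PrimRec f g) (Suc n # xs) y"
| mu: "rec_eval Z f (n # xs) 0 \<Longrightarrow> (\<forall>m<n. \<exists>v. rec_eval Z f (m # xs) (Suc v))
    \<Longrightarrow> rec_eval Z (Mu f) xs n"

inductive_cases rec_eval_elims:
  "rec_eval Z Zero xs y"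
  "rec_eval Z Succ xs y"
  "rec_eval Z (Proj i) xs y"
  "rec_eval Z Oracle xs y"
  "rec_eval Z (Comp f gs) xs y"
  "rec_eval Z (PrimRec f g) (0 # xs) y"
  "rec_eval Z (PrimRec f g) (Suc n # xs) y"
  "rec_eval Z (Mu f) xs y"

lemma rec_eval_functional: "rec_eval Z p xs y \<Longrightarrow> rec_eval Z p xs y' \<Longrightarrow> y = y'"
proof (induction arbitrary: y' rule: rec_eval.induct)
  case (comp xs gs ys f z)
  from comp.prems obtain ys' where ys': "list_all2 (\<lambda>g y. rec_eval Z g xs y) gs ys'"
    and f: "rec_eval Z f ys' y'"
    by (rule rec_eval_elims(5))
  have "ys = ys'"
  proof (rule nth_equalityI)
    show "length ys = length ys'"
      using comp.IH(1) ys' by (simp add: list_all2_conv_all_nth)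
    fix i assume "i < length ys"
    then show "ys ! i = ys' ! i"
      using comp.IH(1) ys' unfolding list_all2_conv_all_nth by metis
  qed
  with f comp.IH(2) show ?case by blast
next
  case (mu f n xs)
  from mu.prems have y': "rec_eval Z f (y' # xs) 0 \<and>
      (\<forall>m<y'. \<exists>v. rec_eval Z f (m # xs) (Suc v))"
    by (rule rec_eval_elims(8)) blast
  have "\<not> n < y'"
  proof
    assume "n < y'"
    then obtain v where "rec_eval Z f (n # xs) (Suc v)" using y' by blast
    with mu.IH(1) show False by (metis nat.distinct(1))
  qed
  moreover have "\<not> y' < n"
  proof
    assume "y' < n"
    then obtain v where "\<forall>y'a. rec_eval Z f (y' # xs) y'a \<longrightarrow> Suc v = y'a"
      using mu.IH(2) by blast
    with y' show False by (metis nat.distinct(1))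
  qed
  ultimately show ?case by simp
next
  case (prec_Suc f g n xs r y)
  from prec_Suc.prems show ?case
    by (rule rec_eval_elims(7)) (metis prec_Suc.IH)
next
  case (prec_0 f xs y g)
  from prec_0.prems show ?case by (rule rec_eval_elims(6)) (rule prec_0.IH)
next
  case (zero xs)
  then show ?case by (rule rec_eval_elims(1)) simp
next
  case (succ x)
  then show ?case by (rule rec_eval_elims(2)) simp
next
  case (proj i xs)
  from proj.prems show ?case by (rule rec_eval_elims(3)) simp
next
  case (query x)
  then show ?case by (rule rec_eval_elims(4)) simp
qed

definition turing_le :: "nat set \<Rightarrow> nat set \<Rightarrow> bool"  (infix "\<le>\<^sub>T" 50) where
  "A \<le>\<^sub>T B \<longleftrightarrow> (\<exists>p. \<forall>x. rec_eval B p [x] (of_bool (x \<in> A)))"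

definition turing_equiv :: "nat set \<Rightarrow> nat set \<Rightarrow> bool"  (infix "\<equiv>\<^sub>T" 50) where
  "A \<equiv>\<^sub>T B \<longleftrightarrow> A \<le>\<^sub>T B \<and> B \<le>\<^sub>T A"

lemma turing_le_refl: "A \<le>\<^sub>T A"
  unfolding turing_le_def using rec_eval.query by blast

primrec replace_oracle :: "prec \<Rightarrow> prec \<Rightarrow> prec" where
  "replace_oracle q Zero = Zero"
| "replace_oracle q Succ = Succ"
| "replace_oracle q (Proj i) = Proj i"
| "replace_oracle q Oracle = q"
| "replace_oracle q (Comp f gs) = Comp (replace_oracle q f) (map (replace_oracle q) gs)"
| "replace_oracle q (PrimRec f g) = PrimRec (replace_oracle q f) (replace_oracle q g)"
| "replace_oracle q (Mu f) = Mu (replace_oracle q f)"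

lemma rec_eval_replace_oracle:
  assumes q: "\<And>x. rec_eval B q [x] (of_bool (x \<in> A))"
  shows "rec_eval A p xs y \<Longrightarrow> rec_eval B (replace_oracle q p) xs y"
proof (induction rule: rec_eval.induct)
  case (comp xs gs ys f z)
  have "list_all2 (\<lambda>g y. rec_eval B g xs y) (map (replace_oracle q) gs) ys"
    using comp.IH(1) by (simp add: list_all2_conv_all_nth)
  with comp.IH(2) show ?case by (auto intro: rec_eval.comp)
next
  case (query x)
  show ?case using q by simp
qed (auto intro: rec_eval.intros)

lemma turing_le_trans: "A \<le>\<^sub>T B \<Longrightarrow> B \<le>\<^sub>T C \<Longrightarrow> A \<le>\<^sub>T C"
  unfolding turing_le_def using rec_eval_replace_oracle by metis

quotient_type tdegree = "nat set" / turing_equiv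
  by (rule equivpI)
    (auto simp: reflp_def symp_def transp_def turing_equiv_def
      intro: turing_le_refl turing_le_trans)

lift_definition deg :: "nat set \<Rightarrow> tdegree" is "\<lambda>A. A" .

instantiation tdegree :: order
begin

lift_definition less_eq_tdegree :: "tdegree \<Rightarrow> tdegree \<Rightarrow> bool" is turing_le
  unfolding turing_equiv_def by (blast intro: turing_le_trans)

definition less_tdegree :: "tdegree \<Rightarrow> tdegree \<Rightarrow> bool" where
  "less_tdegree d e \<longleftrightarrow> d \<le> e \<and> \<not> e \<le> d"

instance
proof
  fix d e f :: tdegree
  show "d < e \<longleftrightarrow> d \<le> e \<and> \<not> e \<le> d" by (rule less_tdegree_def)
  show "d \<le> d" by transfer (rule turing_le_refl)
  show "d \<le> e \<Longrightarrow> e \<le> f \<Longrightarrow> d \<le> f" by transfer (rule turing_le_trans)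
  show "d \<le> e \<Longrightarrow> e \<le> d \<Longrightarrow> d = e" by transfer (simp add: turing_equiv_def)
qed

end

definition is_meet :: "tdegree \<Rightarrow> tdegree \<Rightarrow> tdegree \<Rightarrow> bool" where
  "is_meet d e m \<longleftrightarrow> m \<le> d \<and> m \<le> e \<and> (\<forall>c. c \<le> d \<and> c \<le> e \<longrightarrow> c \<le> m)"

definition set_join :: "nat set \<Rightarrow> nat set \<Rightarrow> nat set" where
  "set_join A B = (\<lambda>x. 2 * x) ` A \<union> (\<lambda>x. 2 * x + 1) ` B"

definition Join :: "nat set \<Rightarrow> (nat \<Rightarrow> nat set) \<Rightarrow> nat set" where
  "Join F X = {prod_encode (m, x) | m x. m \<in> F \<and> x \<in> X m}"

definition upper_cone :: "tdegree \<Rightarrow> tdegree set" where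
  "upper_cone d = {e. d \<le> e}"

definition finitely_generated :: "tdegree set \<Rightarrow> bool" where
  "finitely_generated D \<longleftrightarrow> (\<exists>G. finite G \<and> D = (\<Union>d\<in>G. upper_cone d))"

section \<open>Structures and isomorphism spectra\<close>

text \<open>Relational structures in a language of binary relation symbols \<open>'l\<close>.\<close>

record ('l, 'a) struct =
  univ :: "'a set"
  rel :: "'l \<Rightarrow> 'a \<Rightarrow> 'a \<Rightarrow> bool"

definition is_iso :: "('a \<Rightarrow> 'b) \<Rightarrow> ('l, 'a) struct \<Rightarrow> ('l, 'b) struct \<Rightarrow> bool" where
  "is_iso f A B \<longleftrightarrow> bij_betw f (univ A) (univ B) \<and>
     (\<forall>R. \<forall>x\<in>univ A. \<forall>y\<in>univ A. rel A R x y \<longleftrightarrow> rel B R (f x) (f y))"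

text \<open>
  \<open>computes d c U f\<close>: some (equivalently, every) set of degree \<open>d\<close> computes \<open>f\<close> on \<open>U\<close>, where
  elements are presented to the machine via the Goedel numbering \<open>c\<close>.
\<close>

definition computes :: "tdegree \<Rightarrow> ('a \<Rightarrow> nat) \<Rightarrow> 'a set \<Rightarrow> ('a \<Rightarrow> 'a) \<Rightarrow> bool" where
  "computes d c U f \<longleftrightarrow> (\<exists>Z p. deg Z = d \<and> (\<forall>x\<in>U. rec_eval Z p [c x] (c (f x))))"

definition IsoSpec :: "('a \<Rightarrow> nat) \<Rightarrow> ('l, 'a) struct \<Rightarrow> ('l, 'a) struct \<Rightarrow> tdegree set" where
  "IsoSpec c A B = {d. \<exists>f. is_iso f A B \<and> computes d c (univ A) f}"

section \<open>The linear orders\<close>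

datatype ord_sym = Less

definition omega :: "(ord_sym, nat) struct" where
  "omega = \<lparr>univ = UNIV, rel = (\<lambda>_. (<))\<rparr>"

text \<open>The order determined by an enumeration \<open>x\<close>: the transitive closure of the stipulated relations.\<close>

inductive ce_less :: "(nat \<Rightarrow> nat) \<Rightarrow> nat \<Rightarrow> nat \<Rightarrow> bool" for x :: "nat \<Rightarrow> nat" where
  even: "n < m \<Longrightarrow> ce_less x (2 * n) (2 * m)"
| odd_lower: "ce_less x (2 * x n) (2 * n + 1)"
| odd_upper: "ce_less x (2 * n + 1) (2 * x n + 2)"
| trans: "ce_less x a b \<Longrightarrow> ce_less x b c \<Longrightarrow> ce_less x a c"

definition omega_ce :: "(nat \<Rightarrow> nat) \<Rightarrow> (ord_sym, nat) struct" where
  "omega_ce x = \<lparr>univ = UNIV, rel = (\<lambda>_. ce_less x)\<rparr>"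

definition ce_key :: "(nat \<Rightarrow> nat) \<Rightarrow> nat \<Rightarrow> nat" where
  "ce_key x a = (if even a then a else 2 * x (a div 2) + 1)"

lemma ce_less_iff: "ce_less x a b \<longleftrightarrow> ce_key x a < ce_key x b"
proof
  show "ce_less x a b \<Longrightarrow> ce_key x a < ce_key x b"
    by (induction rule: ce_less.induct) (auto simp: ce_key_def)
next
  have ev: "n \<le> m \<Longrightarrow> 2 * n = 2 * m \<or> ce_less x (2 * n) (2 * m)" for n m
    using ce_less.even[of n m x] by (cases "n = m") auto
  assume less: "ce_key x a < ce_key x b"
  have bounds: "a = 2 * (ce_key x a div 2) \<and> even (ce_key x a) \<or>
      ce_less x (2 * (ce_key x a div 2)) a \<and> ce_less x a (2 * (ce_key x a div 2 + 1)) \<and>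
      odd (ce_key x a)" for a
    using ce_less.odd_lower[of x "a div 2"] ce_less.odd_upper[of x "a div 2"]
    by (auto simp: ce_key_def)
  let ?i = "ce_key x a div 2" and ?j = "ce_key x b div 2"
  show "ce_less x a b"
  proof (cases "?i = ?j")
    case True
    have "even p \<and> odd q" if "p < q" "p div 2 = q div 2" for p q :: nat
      using that by presburger
    with less True have "even (ce_key x a)" "odd (ce_key x b)" by blast+
    with True bounds[of a] bounds[of b] show ?thesis by auto
  next
    case False
    with less have "?i < ?j" by (meson div_le_mono le_neq_implies_less less_imp_le)
    then have ij: "?i < ?j" "?i + 1 \<le> ?j" by simp_all
    have "ce_less x a (2 * ?j)"
      using bounds[of a]
    proof
      assume "a = 2 * ?i \<and> even (ce_key x a)"
      then show ?thesis using ce_less.even[OF ij(1), of x] by metis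
    next
      assume "ce_less x (2 * ?i) a \<and> ce_less x a (2 * (?i + 1)) \<and> odd (ce_key x a)"
      then have "ce_less x a (2 * (?i + 1))" by blast
      with ev[OF ij(2)] show ?thesis by (auto intro: ce_less.trans)
    qed
    moreover have "b = 2 * ?j \<or> ce_less x (2 * ?j) b" using bounds[of b] by blast
    ultimately show ?thesis by (metis ce_less.trans)
  qed
qed

lemma ce_less_total: "inj x \<Longrightarrow> a \<noteq> b \<Longrightarrow> ce_less x a b \<or> ce_less x b a"
proof -
  assume "inj x" "a \<noteq> b"
  then have "ce_key x a \<noteq> ce_key x b"
    unfolding ce_key_def inj_def
    by (metis add_right_cancel dvd_triv_left even_plus_one_iff mult_cancel_left
        odd_two_times_div_two_succ zero_neq_numeral)
  then show ?thesis by (auto simp: ce_less_iff)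
qed

section \<open>Thomason's family\<close>

text \<open>
  \<open>x n\<close> is the fixed enumeration of \<open>X n\<close>. It has to be one-to-one, since otherwise
  \<^const>\<open>ce_less\<close> is not a linear order. No set in the family can be finite: the degree of
  \<open>Join {n} X\<close> is not below that of \<open>Join {} X = {}\<close>.
\<close>

definition uniform_ce_enumeration :: "(nat \<Rightarrow> nat set) \<Rightarrow> (nat \<Rightarrow> nat \<Rightarrow> nat) \<Rightarrow> bool" where
  "uniform_ce_enumeration X x \<longleftrightarrow>
     (\<exists>p. \<forall>n i. rec_eval {} p [n, i] (x n i)) \<and>
     (\<forall>n. inj (x n) \<and> range (x n) = X n)"

definition thomason_family :: "(nat \<Rightarrow> nat set) \<Rightarrow> bool" where
  "thomason_family X \<longleftrightarrow>
     (\<forall>F G. finite F \<longrightarrow> finite G \<longrightarrow>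
        (deg (Join F X) \<le> deg (Join G X) \<longleftrightarrow> F \<subseteq> G) \<and>
        deg (set_join (Join F X) (Join G X)) = deg (Join (F \<union> G) X) \<and>
        is_meet (deg (Join F X)) (deg (Join G X)) (deg (Join (F \<inter> G) X)))"

section \<open>The composite structures\<close>

text \<open>The element \<open>Pt i a\<close> is the point \<open>(i,a)\<close>, with \<open>a \<in> {0,1}\<close> rendered as a truth value.\<close>

datatype hpoint = Fin "nat set" | Pt nat bool

datatype h_sym = E nat | D nat

fun h_rel :: "h_sym \<Rightarrow> hpoint \<Rightarrow> hpoint \<Rightarrow> bool" where
  "h_rel (E i) (Fin X) (Fin Y) \<longleftrightarrow> finite X \<and> finite Y \<and> (X - Y) \<union> (Y - X) = {i}"
| "h_rel (D i) (Fin X) (Pt j a) \<longleftrightarrow> finite X \<and> j = i \<and> (i \<in> X \<longleftrightarrow> a)"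
| "h_rel _ _ _ \<longleftrightarrow> False"

definition Hstruct :: "(h_sym, hpoint) struct" where
  "Hstruct = \<lparr>univ = {Fin X | X. finite X} \<union> {Pt i a | i a. True}, rel = h_rel\<rparr>"

text \<open>\<open>S[{C\<^sub>x}]\<close>; the sum type makes the universe of \<open>S\<close> disjoint from those of the \<open>C\<^sub>x\<close>.\<close>

datatype ('l, 'k) comp_sym = Member | Outer 'l | Inner 'k

fun composite_rel ::
  "('l, 's) struct \<Rightarrow> ('s \<Rightarrow> ('k, 'c) struct) \<Rightarrow> ('l, 'k) comp_sym \<Rightarrow> 's + 'c \<Rightarrow> 's + 'c \<Rightarrow> bool"
where
  "composite_rel S C Member u v \<longleftrightarrow>
     (\<exists>x\<in>univ S. v = Inl x \<and> (u = Inl x \<or> (\<exists>c\<in>univ (C x). u = Inr c)))"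
| "composite_rel S C (Outer R) u v \<longleftrightarrow>
     (\<exists>x\<in>univ S. \<exists>y\<in>univ S. u = Inl x \<and> v = Inl y \<and> rel S R x y)"
| "composite_rel S C (Inner R) u v \<longleftrightarrow>
     (\<exists>x\<in>univ S. \<exists>c\<in>univ (C x). \<exists>d\<in>univ (C x). u = Inr c \<and> v = Inr d \<and> rel (C x) R c d)"

definition composite ::
  "('l, 's) struct \<Rightarrow> ('s \<Rightarrow> ('k, 'c) struct) \<Rightarrow> (('l, 'k) comp_sym, 's + 'c) struct" where
  "composite S C =
     \<lparr>univ = Inl ` univ S \<union> (\<Union>x\<in>univ S. Inr ` univ (C x)), rel = composite_rel S C\<rparr>"

text \<open>\<open>tag z A\<close> is the copy \<open>{z} \<times> A\<close> of \<open>A\<close>.\<close>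

definition tag :: "'z \<Rightarrow> ('k, 'c) struct \<Rightarrow> ('k, 'z \<times> 'c) struct" where
  "tag z A = \<lparr>univ = {z} \<times> univ A,
     rel = (\<lambda>R u v. fst u = z \<and> fst v = z \<and> rel A R (snd u) (snd v))\<rparr>"

fun Mcomp :: "(nat \<Rightarrow> (ord_sym, nat) struct) \<Rightarrow> (nat \<Rightarrow> (ord_sym, nat) struct) \<Rightarrow>
    hpoint \<Rightarrow> (ord_sym, hpoint \<times> nat) struct" where
  "Mcomp A B (Pt i False) = tag (Pt i False) (A (i + 1))"
| "Mcomp A B (Pt i True) = tag (Pt i True) (B (i + 1))"
| "Mcomp A B (Fin X) = tag (Fin X) (if even (card X) then A 0 else B 0)"

fun Ncomp :: "(nat \<Rightarrow> (ord_sym, nat) struct) \<Rightarrow> (nat \<Rightarrow> (ord_sym, nat) struct) \<Rightarrow>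
    hpoint \<Rightarrow> (ord_sym, hpoint \<times> nat) struct" where
  "Ncomp A B (Pt i False) = tag (Pt i False) (A (i + 1))"
| "Ncomp A B (Pt i True) = tag (Pt i True) (B (i + 1))"
| "Ncomp A B (Fin X) = tag (Fin X) (if even (card X) then B 0 else A 0)"

type_synonym mstruct = "((h_sym, ord_sym) comp_sym, hpoint + hpoint \<times> nat) struct"

definition Mstruct ::
  "(nat \<Rightarrow> (ord_sym, nat) struct) \<Rightarrow> (nat \<Rightarrow> (ord_sym, nat) struct) \<Rightarrow> mstruct" where
  "Mstruct A B = composite Hstruct (Mcomp A B)"

definition Nstruct ::
  "(nat \<Rightarrow> (ord_sym, nat) struct) \<Rightarrow> (nat \<Rightarrow> (ord_sym, nat) struct) \<Rightarrow> mstruct" where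
  "Nstruct A B = composite Hstruct (Ncomp A B)"

text \<open>
  The Goedel numbering under which the composites are structures on the natural numbers; finite
  sets are represented by their canonical indices.
\<close>

fun hcode :: "hpoint \<Rightarrow> nat" where
  "hcode (Fin X) = sum_encode (Inl (set_encode X))"
| "hcode (Pt i a) = sum_encode (Inr (2 * i + of_bool a))"

fun mcode :: "hpoint + hpoint \<times> nat \<Rightarrow> nat" where
  "mcode (Inl z) = sum_encode (Inl (hcode z))"
| "mcode (Inr (z, n)) = sum_encode (Inr (prod_encode (hcode z, n)))"

lemma bij_hcode: "bij_betw hcode (univ Hstruct) UNIV"
proof (rule bij_betwI')
  have bits: "2 * i + of_bool a = 2 * j + of_bool b \<longleftrightarrow> i = j \<and> a = b" for i j :: nat and a b
    by (cases a; cases b; simp; presburger)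
  have bit: b if "Suc (2 * i) = 2 * j + of_bool b" for i j :: nat and b
    using that by (cases b; simp; presburger)
  fix u v assume "u \<in> univ Hstruct" "v \<in> univ Hstruct"
  then show "hcode u = hcode v \<longleftrightarrow> u = v"
    by (auto simp: Hstruct_def set_encode_eq sum_encode_eq bits dest: bit bit[OF sym])
next
  fix k
  obtain s where k: "k = sum_encode s" by (metis sum_decode_inverse)
  show "\<exists>u\<in>univ Hstruct. k = hcode u"
  proof (cases s)
    case (Inl m)
    then have "k = hcode (Fin (set_decode m))" by (simp add: k)
    moreover have "Fin (set_decode m) \<in> univ Hstruct" by (simp add: Hstruct_def)
    ultimately show ?thesis by blast
  next
    case (Inr m)
    then have "k = hcode (Pt (m div 2) (odd m))" by (simp add: k)
    moreover have "Pt (m div 2) (odd m) \<in> univ Hstruct" by (simp add: Hstruct_def)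
    ultimately show ?thesis by blast
  qed
qed auto

lemma bij_mcode:
  assumes "\<And>n. univ (A n) = UNIV" "\<And>n. univ (B n) = UNIV"
  shows "bij_betw mcode (univ (Mstruct A B)) UNIV" "bij_betw mcode (univ (Nstruct A B)) UNIV"
proof -
  let ?U = "Inl ` univ Hstruct \<union> Inr ` (univ Hstruct \<times> UNIV)"
  have "univ (Mcomp A B z) = {z} \<times> UNIV" "univ (Ncomp A B z) = {z} \<times> UNIV" for z
    using assms by (cases "(A, B, z)" rule: Mcomp.cases; simp add: tag_def)+
  then have U: "univ (Mstruct A B) = ?U" "univ (Nstruct A B) = ?U"
    by (auto simp: Mstruct_def Nstruct_def composite_def)
  have inj: "hcode z = hcode z' \<longleftrightarrow> z = z'" if "z \<in> univ Hstruct" "z' \<in> univ Hstruct" for z z'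
    using bij_hcode that by (auto simp: bij_betw_def inj_on_def)
  have surj: "\<exists>z\<in>univ Hstruct. hcode z = k" for k
    using bij_hcode by (metis UNIV_I bij_betw_imp_surj_on imageE)
  have "bij_betw mcode ?U UNIV"
  proof (rule bij_betwI')
    fix u v :: "hpoint + hpoint \<times> nat"
    assume "u \<in> ?U" "v \<in> ?U"
    then show "mcode u = mcode v \<longleftrightarrow> u = v"
      by (auto simp: sum_encode_eq prod_encode_eq inj)
  next
    fix k
    obtain s where k: "k = sum_encode s" by (metis sum_decode_inverse)
    show "\<exists>u\<in>?U. k = mcode u"
    proof (cases s)
      case (Inl m)
      obtain z where "z \<in> univ Hstruct" "hcode z = m" using surj by blast
      then show ?thesis using Inl k by (intro bexI[of _ "Inl z"]) auto
    next
      case (Inr m)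
      obtain a n where m: "m = prod_encode (a, n)" by (metis prod_decode_inverse surj_pair)
      obtain z where "z \<in> univ Hstruct" "hcode z = a" using surj by blast
      then show ?thesis using Inr k m by (intro bexI[of _ "Inr (z, n)"]) auto
    qed
  qed auto
  with U show "bij_betw mcode (univ (Mstruct A B)) UNIV" "bij_betw mcode (univ (Nstruct A B)) UNIV"
    by simp_all
qed

end

theory Submission
  imports Defs
begin

text \<open>An isomorphism of \<open>M\<close> onto \<open>N\<close> acts on the finite sets as \<open>X \<mapsto> X \<triangle> G\<close> for a finite \<open>G\<close>,
  and somewhere it restricts to the isomorphism of \<open>(\<omega>, <)\<close> onto \<open>(\<omega>, <\<^bsub>X\<^sub>j\<^esub>)\<close>: with \<open>j = i + 1\<close> if
  \<open>i \<in> G\<close>, and with \<open>j = 0\<close> if \<open>G = {}\<close>. So every degree in the spectrum bounds some \<open>d\<^bsub>{j}\<^esub>\<close>.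
  Conversely, \<open>G = {i}\<close> gives an isomorphism computable from \<open>d\<^bsub>{i + 1}\<^esub>\<close>. A generator below
  \<open>d\<^bsub>{i + 1}\<^esub>\<close> bounds some \<open>d\<^bsub>{j}\<^esub>\<close>, and then \<open>j = i + 1\<close>; hence different \<open>i\<close> need different
  generators.\<close>

section \<open>Total functions recursive in an oracle\<close>

text \<open>Arguments come as one list, so that one rule about bodies in \<open>xs\<close> serves
  every arity and nested terms can be treated by introduction rules.\<close>

definition recursive_in :: "nat set \<Rightarrow> nat \<Rightarrow> (nat list \<Rightarrow> nat) \<Rightarrow> bool" where
  "recursive_in Z k f \<longleftrightarrow> (\<exists>p. \<forall>xs. length xs = k \<longrightarrow> rec_eval Z p xs (f xs))"

abbreviation recursive1 :: "nat set \<Rightarrow> (nat \<Rightarrow> nat) \<Rightarrow> bool" where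
  "recursive1 Z f \<equiv> recursive_in Z 1 (\<lambda>xs. f (xs ! 0))"

abbreviation recursive2 :: "nat set \<Rightarrow> (nat \<Rightarrow> nat \<Rightarrow> nat) \<Rightarrow> bool" where
  "recursive2 Z f \<equiv> recursive_in Z 2 (\<lambda>xs. f (xs ! 0) (xs ! 1))"

lemma length_1_conv: "length xs = 1 \<longleftrightarrow> (\<exists>a. xs = [a])"
  by (auto simp: length_Suc_conv)

lemma length_2_conv: "length xs = 2 \<longleftrightarrow> (\<exists>a b. xs = [a, b])"
  by (auto simp: length_Suc_conv numeral_2_eq_2)

lemma recursive_in_cong:
  assumes "recursive_in Z k f" "\<And>xs. length xs = k \<Longrightarrow> f xs = g xs"
  shows "recursive_in Z k g"
  using assms unfolding recursive_in_def by metis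

lemma recursive1_iff: "recursive1 Z f \<longleftrightarrow> (\<exists>p. \<forall>n. rec_eval Z p [n] (f n))"
  unfolding recursive_in_def length_1_conv by (metis nth_Cons_0)

lemma recursive2_iff: "recursive2 Z f \<longleftrightarrow> (\<exists>p. \<forall>m n. rec_eval Z p [m, n] (f m n))"
  unfolding recursive_in_def length_2_conv
  by (metis nth_Cons_0 nth_Cons_Suc One_nat_def)

lemma recursive_in_comp:
  assumes f: "recursive_in Z (length gs) f" and gs: "\<And>g. g \<in> set gs \<Longrightarrow> recursive_in Z k g"
  shows "recursive_in Z k (\<lambda>xs. f (map (\<lambda>g. g xs) gs))"
proof -
  obtain p where p: "length xs = length gs \<Longrightarrow> rec_eval Z p xs (f xs)" for xs
    using f unfolding recursive_in_def by blast
  obtain q where q: "g \<in> set gs \<Longrightarrow> length xs = k \<Longrightarrow> rec_eval Z (q g) xs (g xs)" for g xs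
    using gs unfolding recursive_in_def by metis
  have "rec_eval Z (Comp p (map q gs)) xs (f (map (\<lambda>g. g xs) gs))" if "length xs = k" for xs
    using that by (intro rec_eval.comp[OF _ p]) (auto simp: list_all2_conv_all_nth intro: q)
  then show ?thesis unfolding recursive_in_def by blast
qed

lemma recursive_in_comp1:
  assumes "recursive1 Z f" "recursive_in Z k a"
  shows "recursive_in Z k (\<lambda>xs. f (a xs))"
  using recursive_in_comp[of Z "[a]" "\<lambda>xs. f (xs ! 0)" k] assms by simp

lemma recursive_in_comp2:
  assumes "recursive2 Z f" "recursive_in Z k a" "recursive_in Z k b"
  shows "recursive_in Z k (\<lambda>xs. f (a xs) (b xs))"
  using recursive_in_comp[of Z "[a, b]" "\<lambda>xs. f (xs ! 0) (xs ! 1)" k] assms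
  by (auto simp: numeral_2_eq_2)

lemma recursive_in_arg: "i < k \<Longrightarrow> recursive_in Z k (\<lambda>xs. xs ! i)"
  unfolding recursive_in_def by (metis rec_eval.proj)

lemma recursive_in_Suc: "recursive_in Z k a \<Longrightarrow> recursive_in Z k (\<lambda>xs. Suc (a xs))"
  by (rule recursive_in_comp1[where f = Suc]) (unfold recursive1_iff, blast intro: rec_eval.succ)

lemma recursive_in_const: "recursive_in Z k (\<lambda>_. c)"
proof (induction c)
  case 0
  show ?case unfolding recursive_in_def by (metis rec_eval.zero)
qed (rule recursive_in_Suc)

lemma recursive_in_oracle:
  "recursive_in Z k a \<Longrightarrow> recursive_in Z k (\<lambda>xs. of_bool (a xs \<in> Z))"
  by (rule recursive_in_comp1[where f = "\<lambda>n. of_bool (n \<in> Z)"])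
    (unfold recursive1_iff[where f = "\<lambda>n. of_bool (n \<in> Z)"], blast intro: rec_eval.query)

section \<open>Primitive recursion and minimisation\<close>

lemma recursive_in_rec_nat:
  assumes "recursive_in Z k f" "recursive_in Z (Suc (Suc k)) g"
  shows "recursive_in Z (Suc k)
    (\<lambda>xs. rec_nat (f (tl xs)) (\<lambda>n r. g (n # r # tl xs)) (hd xs))"
proof -
  obtain p q where p: "length xs = k \<Longrightarrow> rec_eval Z p xs (f xs)"
    and q: "length xs = Suc (Suc k) \<Longrightarrow> rec_eval Z q xs (g xs)" for xs
    using assms unfolding recursive_in_def by blast
  \<comment> \<open>\<open>PrimRec\<close> recurses on the head; the step code receives counter,
    previous value and parameters, in this order.\<close>
  have "rec_eval Z (PrimRec p q) (n # ys) (rec_nat (f ys) (\<lambda>n r. g (n # r # ys)) n)"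
    if "length ys = k" for n ys
    by (induction n) (auto intro!: rec_eval.prec_0 rec_eval.prec_Suc p q simp: that)
  then show ?thesis
    unfolding recursive_in_def length_Suc_conv by (intro exI[of _ "PrimRec p q"]) auto
qed

lemma recursive1_primrec:
  assumes "recursive2 Z h" "\<And>n. f (Suc n) = h n (f n)"
  shows "recursive1 Z f"
proof -
  have "rec_nat (f 0) h n = f n" for n by (induction n) (simp_all add: assms(2))
  then have eq: "rec_nat (f 0) h (hd xs) = f (xs ! 0)" if "length xs = 1" for xs
    using that by (auto simp: length_Suc_conv)
  have "recursive_in Z (Suc 0) (\<lambda>xs. rec_nat (f 0)
      (\<lambda>n r. h ((n # r # tl xs) ! 0) ((n # r # tl xs) ! 1)) (hd xs))"
    using assms(1)
    by (intro recursive_in_rec_nat recursive_in_const) (simp add: numeral_2_eq_2)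
  then have "recursive_in Z 1 (\<lambda>xs. rec_nat (f 0) h (hd xs))" by simp
  then show ?thesis by (rule recursive_in_cong) (rule eq)
qed

text \<open>The parameter \<open>y\<close> enters only through the initial value; the step sees
  counter and previous value. This covers addition and truncated subtraction.\<close>

lemma recursive2_primrec:
  assumes "recursive1 Z a" "recursive2 Z h"
    and "\<And>y. f 0 y = a y" "\<And>n y. f (Suc n) y = h n (f n y)"
  shows "recursive2 Z f"
proof -
  have eq: "rec_nat (a y) h n = f n y" for n y by (induction n) (simp_all add: assms)
  have "recursive_in Z 3 (\<lambda>xs. h (xs ! 0) (xs ! 1))"
    by (rule recursive_in_comp2[OF assms(2)]) (auto intro: recursive_in_arg)
  then have "recursive_in Z (Suc 1) (\<lambda>xs. rec_nat (a (tl xs ! 0))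
      (\<lambda>n r. h ((n # r # tl xs) ! 0) ((n # r # tl xs) ! 1)) (hd xs))"
    using assms(1) by (intro recursive_in_rec_nat) (simp_all add: numeral_3_eq_3)
  then have "recursive_in Z 2 (\<lambda>xs. rec_nat (a (tl xs ! 0)) h (hd xs))"
    by (simp add: numeral_2_eq_2)
  then show ?thesis
    by (rule recursive_in_cong) (auto simp: length_2_conv eq)
qed

text \<open>Existence of a zero makes the unbounded search stop; since \<open>f\<close> is total,
  every earlier test converges to a successor, as \<open>Mu\<close> demands.\<close>

lemma recursive_in_Least:
  assumes f: "recursive_in Z (Suc k) f" and ex: "\<And>xs. length xs = k \<Longrightarrow> \<exists>n. f (n # xs) = 0"
  shows "recursive_in Z k (\<lambda>xs. LEAST n. f (n # xs) = 0)"
proof -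
  obtain p where p: "length xs = Suc k \<Longrightarrow> rec_eval Z p xs (f xs)" for xs
    using f unfolding recursive_in_def by blast
  have "rec_eval Z (Mu p) xs (LEAST n. f (n # xs) = 0)" if len: "length xs = k" for xs
  proof (rule rec_eval.mu)
    have "f ((LEAST n. f (n # xs) = 0) # xs) = 0" using ex[OF len] by (rule LeastI_ex)
    then show "rec_eval Z p ((LEAST n. f (n # xs) = 0) # xs) 0"
      using p[of "(LEAST n. f (n # xs) = 0) # xs"] len by simp
    show "\<forall>m<LEAST n. f (n # xs) = 0. \<exists>v. rec_eval Z p (m # xs) (Suc v)"
    proof (intro allI impI)
      fix m assume "m < (LEAST n. f (n # xs) = 0)"
      then have "f (m # xs) \<noteq> 0" by (rule not_less_Least)
      then show "\<exists>v. rec_eval Z p (m # xs) (Suc v)"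
        using p[of "m # xs"] len by (metis length_Cons not0_implies_Suc)
    qed
  qed
  then show ?thesis unfolding recursive_in_def by blast
qed

section \<open>Arithmetic, comparisons and case distinction\<close>

lemma recursive_in_add:
  assumes "recursive_in Z k a" "recursive_in Z k b"
  shows "recursive_in Z k (\<lambda>xs. a xs + b xs)"
proof (rule recursive_in_comp2[OF _ assms], rule recursive2_primrec)
  show "recursive2 Z (\<lambda>_ r. Suc r)" by (intro recursive_in_Suc recursive_in_arg) simp
  show "recursive1 Z (\<lambda>y. y)" by (intro recursive_in_arg) simp
qed simp_all

lemma recursive_in_diff:
  assumes "recursive_in Z k a" "recursive_in Z k b"
  shows "recursive_in Z k (\<lambda>xs. a xs - b xs)"
proof -
  have pred: "recursive1 Z (\<lambda>n. n - 1)"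
    by (rule recursive1_primrec[where h = "\<lambda>n _. n"]) (auto intro: recursive_in_arg)
  \<comment> \<open>Recursion runs on the subtrahend, which therefore comes first; the arguments are
    swapped back at the end.\<close>
  have "recursive2 Z (\<lambda>n y. y - n)"
  proof (rule recursive2_primrec)
    show "recursive2 Z (\<lambda>_ r. r - 1)" by (intro recursive_in_comp1[OF pred] recursive_in_arg) simp
    show "recursive1 Z (\<lambda>y. y)" by (intro recursive_in_arg) simp
  qed simp_all
  from recursive_in_comp2[OF this assms(2,1)] show ?thesis .
qed

lemma recursive_in_If:
  assumes c: "recursive_in Z k (\<lambda>xs. of_bool (P xs))"
    and a: "recursive_in Z k a" and b: "recursive_in Z k b"
  shows "recursive_in Z k (\<lambda>xs. if P xs then a xs else b xs)"
proof -
  have eq: "rec_nat u (\<lambda>_ _. v) n = (if n = 0 then u else v)" for u v n :: nat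
    by (cases n) simp_all
  \<comment> \<open>Recursion on the truth value: the start is the else branch, and every step
    returns the then branch whatever came before.\<close>
  have "recursive_in Z (Suc 2) (\<lambda>xs. rec_nat (tl xs ! 1) (\<lambda>n r. (n # r # tl xs) ! 2) (hd xs))"
    by (intro recursive_in_rec_nat recursive_in_arg) simp_all
  then have *: "recursive_in Z 3 (\<lambda>xs. if hd xs = 0 then tl xs ! 1 else tl xs ! 0)"
    by (simp add: eq numeral_2_eq_2 numeral_3_eq_3 cong: if_cong)
  have "recursive_in Z k (\<lambda>xs. (\<lambda>xs. if hd xs = 0 then tl xs ! 1 else tl xs ! 0)
      (map (\<lambda>g. g xs) [\<lambda>xs. of_bool (P xs), a, b]))"
    by (rule recursive_in_comp) (use * c a b in \<open>auto simp: numeral_3_eq_3\<close>)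
  then show ?thesis by (rule recursive_in_cong) simp
qed

lemma recursive_in_not:
  assumes "recursive_in Z k (\<lambda>xs. of_bool (P xs))"
  shows "recursive_in Z k (\<lambda>xs. of_bool (\<not> P xs))"
  by (rule recursive_in_cong[OF recursive_in_If[OF assms recursive_in_const recursive_in_const]])
    auto

lemma recursive1_Least:
  assumes P: "recursive2 Z (\<lambda>n y. of_bool (P n y))" and "\<And>y. \<exists>n. P n y"
  shows "recursive1 Z (\<lambda>y. LEAST n. P n y)"
proof -
  have "recursive_in Z 1 (\<lambda>xs. LEAST n. of_bool (\<not> P ((n # xs) ! 0) ((n # xs) ! 1)) = (0::nat))"
    using assms(2) recursive_in_not[OF P]
    by (intro recursive_in_Least) (simp_all add: numeral_2_eq_2)
  then show ?thesis by simp
qed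

lemma recursive_in_conj:
  assumes "recursive_in Z k (\<lambda>xs. of_bool (P xs))" "recursive_in Z k (\<lambda>xs. of_bool (Q xs))"
  shows "recursive_in Z k (\<lambda>xs. of_bool (P xs \<and> Q xs))"
  by (rule recursive_in_cong[OF recursive_in_If[OF assms recursive_in_const[where c = 0]]]) auto

text \<open>With truncated subtraction, the truth value of \<open>a < b\<close> is
  \<open>1 - (Suc a - b)\<close>.\<close>

lemma recursive_in_less:
  assumes "recursive_in Z k a" "recursive_in Z k b"
  shows "recursive_in Z k (\<lambda>xs. of_bool (a xs < b xs))"
  by (rule recursive_in_cong[OF recursive_in_diff[OF
          recursive_in_const[where c = 1] recursive_in_diff[OF recursive_in_Suc[OF assms(1)] assms(2)]]])
    auto

lemma recursive_in_eq:
  assumes "recursive_in Z k a" "recursive_in Z k b"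
  shows "recursive_in Z k (\<lambda>xs. of_bool (a xs = b xs))"
  by (rule recursive_in_cong[OF recursive_in_conj[OF
          recursive_in_not[OF recursive_in_less[OF assms]]
          recursive_in_not[OF recursive_in_less[OF assms(2,1)]]]])
    (simp add: not_less eq_iff conj_commute)

lemma recursive_in_double:
  "recursive_in Z k a \<Longrightarrow> recursive_in Z k (\<lambda>xs. 2 * a xs)"
  using recursive_in_add[of Z k a a] by (simp add: mult_2)

lemma recursive_in_mod_2:
  assumes "recursive_in Z k a"
  shows "recursive_in Z k (\<lambda>xs. a xs mod 2)"
  by (rule recursive_in_comp1[OF _ assms], rule recursive1_primrec[where h = "\<lambda>_ r. 1 - r"])
    (auto intro!: recursive_in_diff recursive_in_arg recursive_in_const simp: mod_Suc)

lemma recursive_in_even: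
  assumes "recursive_in Z k a"
  shows "recursive_in Z k (\<lambda>xs. of_bool (even (a xs)))"
  using recursive_in_eq[OF recursive_in_mod_2[OF assms] recursive_in_const[where c = 0]]
  by (simp add: even_iff_mod_2_eq_zero)

text \<open>The half grows by one exactly when passing from an odd \<open>n\<close> to
  \<open>Suc n\<close>, so the increment is \<open>n mod 2\<close>.\<close>

lemma recursive_in_div_2:
  assumes "recursive_in Z k a"
  shows "recursive_in Z k (\<lambda>xs. a xs div 2)"
  by (rule recursive_in_comp1[OF _ assms], rule recursive1_primrec[where h = "\<lambda>n r. r + n mod 2"])
    (auto intro!: recursive_in_add recursive_in_arg recursive_in_mod_2, presburger)

lemma recursive_in_div_power_2:
  assumes "recursive_in Z k a"
  shows "recursive_in Z k (\<lambda>xs. a xs div 2 ^ i)"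
proof (induction i)
  case (Suc i)
  from recursive_in_div_2[OF this] show ?case
    by (simp only: div_mult2_eq power_Suc mult.commute[of 2])
qed (simp add: assms)

section \<open>The Cantor pairing function and its inverse\<close>

lemma recursive_in_triangle:
  assumes "recursive_in Z k a"
  shows "recursive_in Z k (\<lambda>xs. triangle (a xs))"
  by (rule recursive_in_comp1[OF _ assms], rule recursive1_primrec[where h = "\<lambda>n r. r + Suc n"])
    (auto intro!: recursive_in_add recursive_in_arg recursive_in_Suc)

lemma recursive_in_prod_encode:
  assumes "recursive_in Z k a" "recursive_in Z k b"
  shows "recursive_in Z k (\<lambda>xs. prod_encode (a xs, b xs))"
  unfolding prod_encode_def
  using assms by (auto intro!: recursive_in_add recursive_in_triangle)

definition diagonal :: "nat \<Rightarrow> nat" where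
  "diagonal v = (LEAST s. v < triangle (Suc s))"

text \<open>\<open>prod_encode (a, b)\<close> is \<open>triangle (a + b) + a\<close>, hence lies
  below \<open>triangle (Suc (a + b))\<close> but not below \<open>triangle (a + b)\<close>. So a
  search recovers the sum of the components.\<close>

lemma diagonal_prod_encode: "diagonal (prod_encode (a, b)) = a + b"
  unfolding diagonal_def
proof (rule Least_equality)
  fix s assume less: "prod_encode (a, b) < triangle (Suc s)"
  have "triangle (Suc s) \<le> triangle (a + b)" if "Suc s \<le> a + b"
    using lift_Suc_mono_le[of triangle, OF _ that] by simp
  with less show "a + b \<le> s" unfolding prod_encode_def by force
qed (simp add: prod_encode_def)

lemma recursive_in_diagonal:
  assumes "recursive_in Z k a"
  shows "recursive_in Z k (\<lambda>xs. diagonal (a xs))"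
proof (rule recursive_in_comp1[OF _ assms])
  have "v < triangle (Suc v)" for v by (induction v) auto
  then have "\<exists>s. v < triangle (Suc s)" for v by blast
  then show "recursive1 Z diagonal"
    unfolding diagonal_def
    by (intro recursive1_Least recursive_in_less recursive_in_triangle
        recursive_in_Suc recursive_in_arg) (simp_all del: triangle_Suc)
qed

text \<open>Once the sum of the components is known, both projections are truncated
  differences.\<close>

lemma prod_decode_diagonal:
  "fst (prod_decode v) = v - triangle (diagonal v)"
  "snd (prod_decode v) = diagonal v - fst (prod_decode v)"
proof -
  obtain a b where v: "v = prod_encode (a, b)" by (metis prod_decode_inverse surj_pair)
  have "v - triangle (diagonal v) = a" "diagonal v = a + b"
    unfolding v diagonal_prod_encode by (simp_all add: prod_encode_def)
  then show "fst (prod_decode v) = v - triangle (diagonal v)"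
    "snd (prod_decode v) = diagonal v - fst (prod_decode v)"
    by (simp_all add: v)
qed

lemma recursive_in_prod_decode:
  assumes "recursive_in Z k a"
  shows "recursive_in Z k (\<lambda>xs. fst (prod_decode (a xs)))"
    "recursive_in Z k (\<lambda>xs. snd (prod_decode (a xs)))"
  unfolding prod_decode_diagonal
  using assms by (auto intro!: recursive_in_diff recursive_in_triangle recursive_in_diagonal)

lemmas recursive_in_intros =
  recursive_in_const recursive_in_arg recursive_in_Suc recursive_in_oracle recursive_in_add
  recursive_in_diff recursive_in_If recursive_in_not recursive_in_conj recursive_in_less
  recursive_in_eq recursive_in_double recursive_in_even recursive_in_div_2
  recursive_in_div_power_2 recursive_in_prod_encode recursive_in_prod_decode

section \<open>Turing reducibility\<close>

lemma turing_le_iff_recursive: "A \<le>\<^sub>T Z \<longleftrightarrow> recursive1 Z (\<lambda>n. of_bool (n \<in> A))"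
  unfolding turing_le_def recursive1_iff[where f = "\<lambda>n. of_bool (n \<in> A)"] ..

text \<open>Each query to \<open>A\<close> is answered by the code that reduces \<open>A\<close> to
  \<open>Z\<close>.\<close>

lemma recursive_in_oracle_mono:
  assumes "A \<le>\<^sub>T Z" "recursive_in A k f"
  shows "recursive_in Z k f"
  using assms unfolding turing_le_def recursive_in_def by (metis rec_eval_replace_oracle)

lemma deg_le_iff: "deg A \<le> deg B \<longleftrightarrow> A \<le>\<^sub>T B"
  by transfer rule

section \<open>The orders of type omega\<close>

text \<open>The number of possible keys below \<open>k\<close>: all even numbers, and
  \<open>2 * n + 1\<close> for each \<open>n\<close> in \<open>X\<close>.\<close>

definition key_rank :: "nat set \<Rightarrow> nat \<Rightarrow> nat" where
  "key_rank X k = Suc k div 2 + card (X \<inter> {..<k div 2})"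

text \<open>For injective \<open>x\<close> this counts the predecessors of \<open>a\<close> in
  \<open>omega_ce x\<close>, so it inverts the isomorphism from \<open>omega\<close>.\<close>

definition ce_rank :: "(nat \<Rightarrow> nat) \<Rightarrow> nat \<Rightarrow> nat" where
  "ce_rank x a = key_rank (range x) (ce_key x a)"

lemma card_Int_lessThan_Suc:
  "card (X \<inter> {..<Suc n}) = card (X \<inter> {..<n}) + of_bool (n \<in> X)"
  by (simp add: lessThan_Suc Int_insert_right)

text \<open>Stepping past \<open>k\<close> counts \<open>k\<close> itself exactly when it can be a
  key.\<close>

lemma key_rank_Suc:
  "key_rank X (Suc k) = key_rank X k + of_bool (even k \<or> k div 2 \<in> X)"
  by (cases "even k") (auto simp: key_rank_def card_Int_lessThan_Suc elim!: evenE oddE)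

lemma key_rank_mono: "k \<le> l \<Longrightarrow> key_rank X k \<le> key_rank X l"
  by (rule lift_Suc_mono_le[of "key_rank X"]) (simp_all add: key_rank_Suc)

lemma ce_key_cases: "even (ce_key x a) \<or> ce_key x a div 2 \<in> range x"
  by (simp add: ce_key_def)

lemma ce_key_even [simp]: "ce_key x (2 * n) = 2 * n"
  by (simp add: ce_key_def)

lemma ce_key_odd [simp]: "ce_key x (Suc (2 * m)) = Suc (2 * x m)"
  by (simp add: ce_key_def)

lemma ce_key_surj: "even k \<or> k div 2 \<in> range x \<Longrightarrow> \<exists>a. ce_key x a = k"
  by (metis ce_key_even ce_key_odd evenE even_Suc_div_two odd_Suc_div_two odd_two_times_div_two_succ
      Suc_eq_plus1 imageE)

text \<open>The rank rises by one immediately after each key that occurs and never falls, so it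
  orders elements as their keys do.\<close>

lemma ce_less_iff_rank: "ce_less x a b \<longleftrightarrow> ce_rank x a < ce_rank x b"
proof
  assume "ce_less x a b"
  then have "Suc (ce_key x a) \<le> ce_key x b" by (simp add: ce_less_iff)
  from key_rank_mono[OF this, of "range x"] show "ce_rank x a < ce_rank x b"
    using ce_key_cases[of x a] by (simp add: ce_rank_def key_rank_Suc)
next
  assume "ce_rank x a < ce_rank x b"
  then show "ce_less x a b"
    unfolding ce_less_iff ce_rank_def using key_rank_mono[of "ce_key x b" "ce_key x a" "range x"]
    by linarith
qed

lemma surj_ce_rank: "\<exists>a. ce_rank x a = k"
proof (induction k)
  case 0
  show ?case by (intro exI[of _ 0]) (simp add: ce_rank_def key_rank_def ce_key_def)
next
  case (Suc k)
  then obtain a where a: "ce_rank x a = k" by blast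
  let ?k = "ce_key x a"
  have k: "key_rank (range x) (Suc ?k) = Suc k"
    using a ce_key_cases[of x a] by (simp add: ce_rank_def key_rank_Suc)
  show ?case
  \<comment> \<open>The next key that occurs is \<open>Suc ?k\<close> or the number after it: if
    \<open>Suc ?k\<close> is missing it is odd, and the even number after it always occurs.\<close>
  proof (cases "even (Suc ?k) \<or> Suc ?k div 2 \<in> range x")
    case True
    then show ?thesis using ce_key_surj[OF True] k unfolding ce_rank_def by metis
  next
    case False
    then have "key_rank (range x) (Suc (Suc ?k)) = Suc k" using k by (simp add: key_rank_Suc[of _ "Suc ?k"])
    moreover obtain b where "ce_key x b = Suc (Suc ?k)"
      using ce_key_surj[of "Suc (Suc ?k)" x] False by auto
    ultimately show ?thesis unfolding ce_rank_def by metis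
  qed
qed

lemma bij_ce_rank:
  assumes "inj x"
  shows "bij (ce_rank x)"
proof (rule bijI)
  show "inj (ce_rank x)"
    using ce_less_total[OF assms] by (intro injI) (metis ce_less_iff_rank less_irrefl)
  show "surj (ce_rank x)" using surj_ce_rank by (metis surjI)
qed

lemma is_iso_omega_ce:
  assumes "inj x"
  shows "is_iso (ce_rank x) (omega_ce x) omega" "is_iso (inv (ce_rank x)) omega (omega_ce x)"
  using bij_ce_rank[OF assms]
  by (auto simp: is_iso_def omega_def omega_ce_def ce_less_iff_rank bij_imp_bij_inv
      surj_f_inv_f[OF bij_is_surj])

section \<open>Computing the isomorphism from the set, and the set from the isomorphism\<close>

lemma recursive1_ce_rank:
  assumes X: "range x \<le>\<^sub>T Z" and x: "recursive1 Z x"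
  shows "recursive1 Z (ce_rank x)"
proof -
  have mem: "recursive1 Z (\<lambda>n. of_bool (n \<in> range x))"
    using X by (simp only: turing_le_iff_recursive)
  \<comment> \<open>Counting is a primitive recursion that asks one membership question per
    step.\<close>
  have count: "recursive1 Z (\<lambda>m. card (range x \<inter> {..<m}))"
  proof (rule recursive1_primrec)
    show "recursive2 Z (\<lambda>n r. r + of_bool (n \<in> range x))"
      by (intro recursive_in_add recursive_in_comp1[OF mem] recursive_in_arg) simp_all
  qed (rule card_Int_lessThan_Suc)
  have key: "recursive1 Z (ce_key x)"
    unfolding ce_key_def Suc_eq_plus1[symmetric]
    by (intro recursive_in_intros recursive_in_comp1[OF x]) simp_all
  have "recursive1 Z (key_rank (range x))"
    unfolding key_rank_def
    by (intro recursive_in_intros recursive_in_comp1[OF count]) simp_all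
  from recursive_in_comp1[OF this key] show ?thesis by (simp only: ce_rank_def)
qed

text \<open>The preimage is found by unbounded search, which ends because \<open>f\<close> is
  onto.\<close>

lemma recursive1_inv:
  assumes f: "recursive1 Z f" and bij: "bij f"
  shows "recursive1 Z (inv f)"
proof -
  have eq: "(LEAST a. f a = k) = inv f k" for k
    using bij by (intro Least_equality) (auto simp: surj_f_inv_f[OF bij_is_surj] bij_is_inj inv_f_f)
  have "\<exists>a. f a = k" for k using bij by (metis bij_pointE)
  then have "recursive1 Z (\<lambda>k. LEAST a. f a = k)"
    by (intro recursive1_Least recursive_in_eq recursive_in_comp1[OF f] recursive_in_arg)
      simp_all
  then show ?thesis by (simp only: eq)
qed

text \<open>In \<open>\<omega>\<^sub>x\<close> the immediate successor of \<open>2 * n\<close> is odd exactly if some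
  \<open>2 * m + 1\<close> was inserted above it, that is if \<open>n\<close> is enumerated.\<close>

lemma iso_omega_ce_successor:
  assumes iso: "is_iso \<phi> omega (omega_ce x)" and k: "\<phi> k = 2 * n"
  shows "n \<in> range x \<longleftrightarrow> odd (\<phi> (Suc k))"
proof -
  have less: "a < b \<longleftrightarrow> ce_key x (\<phi> a) < ce_key x (\<phi> b)" for a b
    using iso by (simp add: is_iso_def omega_def omega_ce_def ce_less_iff)
  have surj: "\<exists>l. \<phi> l = b" for b
    using iso by (simp add: is_iso_def omega_def omega_ce_def bij_pointE) (metis bij_pointE)
  have succ: "ce_key x (\<phi> (Suc k)) \<le> ce_key x b" if "2 * n < ce_key x b" for b
  proof -
    obtain l where l: "\<phi> l = b" using surj by blast
    then have "k < l" using that less[of k l] k by simp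
    then show ?thesis using less[of l "Suc k"] l by (simp add: not_less[symmetric])
  qed
  have gt: "2 * n < ce_key x (\<phi> (Suc k))" using less[of k "Suc k"] k by simp
  show ?thesis
  proof
    assume "n \<in> range x"
    then obtain m where "x m = n" by blast
    then have "ce_key x (\<phi> (Suc k)) = Suc (2 * n)"
      using succ[of "Suc (2 * m)"] gt by simp
    then show "odd (\<phi> (Suc k))" by (metis ce_key_even even_Suc dvd_triv_left evenE)
  next
    assume "odd (\<phi> (Suc k))"
    then obtain m where "\<phi> (Suc k) = Suc (2 * m)" by (metis oddE Suc_eq_plus1)
    \<comment> \<open>The key \<open>Suc (2 * x m)\<close> exceeds \<open>2 * n\<close> and is at
      most the key of \<open>2 * Suc n\<close>, which pins down \<open>x m\<close>.\<close>
    then have "x m = n" using gt succ[of "2 * Suc n"] unfolding ce_key_even by simp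
    then show "n \<in> range x" by blast
  qed
qed

text \<open>The position of \<open>2 * n\<close> is found by search; the parity of the next element
  then decides whether \<open>n\<close> is enumerated.\<close>

lemma turing_le_of_iso_omega_ce:
  assumes iso: "is_iso \<phi> omega (omega_ce x)" and \<phi>: "recursive1 Z \<phi>"
  shows "range x \<le>\<^sub>T Z"
proof -
  have ex: "\<exists>k. \<phi> k = 2 * n" for n
    using iso by (simp add: is_iso_def omega_def omega_ce_def) (metis bij_pointE)
  have least: "recursive1 Z (\<lambda>n. LEAST k. \<phi> k = 2 * n)"
    using ex
    by (intro recursive1_Least recursive_in_eq recursive_in_comp1[OF \<phi>] recursive_in_double
        recursive_in_arg) simp_all
  have "recursive1 Z (\<lambda>n. of_bool (odd (\<phi> (Suc (LEAST k. \<phi> k = 2 * n)))))"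
    by (intro recursive_in_intros recursive_in_comp1[OF \<phi>] recursive_in_comp1[OF least]) simp
  moreover have "odd (\<phi> (Suc (LEAST k. \<phi> k = 2 * n))) \<longleftrightarrow> n \<in> range x" for n
    using iso_omega_ce_successor[OF iso LeastI_ex[OF ex]] by blast
  ultimately show ?thesis by (simp only: turing_le_iff_recursive)
qed

section \<open>Isomorphisms of composites\<close>

lemma univ_composite_tag:
  "univ (composite S (\<lambda>z. tag z (P z))) = Inl ` univ S \<union> Inr ` (SIGMA z:univ S. univ (P z))"
  by (auto simp: composite_def tag_def)

lemma composite_tag_Member:
  "rel (composite S (\<lambda>z. tag z (P z))) Member u (Inl z) \<longleftrightarrow>
     z \<in> univ S \<and> (u = Inl z \<or> (\<exists>c\<in>univ (P z). u = Inr (z, c)))"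
  "\<not> rel (composite S (\<lambda>z. tag z (P z))) Member u (Inr w)"
  by (auto simp: composite_def tag_def)

lemma composite_tag_Outer:
  "rel (composite S (\<lambda>z. tag z (P z))) (Outer R) u v \<longleftrightarrow>
     (\<exists>x\<in>univ S. \<exists>y\<in>univ S. u = Inl x \<and> v = Inl y \<and> rel S R x y)"
  by (simp add: composite_def)

lemma composite_tag_Inner:
  "rel (composite S (\<lambda>z. tag z (P z))) (Inner R) (Inr (z, c)) (Inr (z', d)) \<longleftrightarrow>
     z' = z \<and> z \<in> univ S \<and> c \<in> univ (P z) \<and> d \<in> univ (P z) \<and> rel (P z) R c d"
  "\<not> rel (composite S (\<lambda>z. tag z (P z))) (Inner R) (Inl y) v"
  "\<not> rel (composite S (\<lambda>z. tag z (P z))) (Inner R) u (Inl y)"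
  by (auto simp: composite_def tag_def)

text \<open>The outer points are exactly the \<open>u\<close> related to themselves by
  \<open>Member\<close>, and the fibre over \<open>z\<close> consists of the other elements that
  \<open>Member\<close> relates to \<open>Inl z\<close>. So \<open>f\<close> acts on outer points by
  some \<open>h\<close>, and on each fibre by some \<open>\<phi> z\<close>.\<close>

lemma composite_tag_iso_elim:
  assumes iso: "is_iso f (composite S (\<lambda>z. tag z (P z))) (composite S (\<lambda>z. tag z (Q z)))"
  obtains h \<phi> where "\<And>z. z \<in> univ S \<Longrightarrow> h z \<in> univ S"
    and "\<And>R y z. y \<in> univ S \<Longrightarrow> z \<in> univ S \<Longrightarrow> rel S R y z \<longleftrightarrow> rel S R (h y) (h z)"
    and "\<And>z. z \<in> univ S \<Longrightarrow> is_iso (\<phi> z) (P z) (Q (h z))"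
    and "\<And>z c. z \<in> univ S \<Longrightarrow> c \<in> univ (P z) \<Longrightarrow> f (Inr (z, c)) = Inr (h z, \<phi> z c)"
proof -
  let ?M = "composite S (\<lambda>z. tag z (P z))" and ?N = "composite S (\<lambda>z. tag z (Q z))"
  have inj: "inj_on f (univ ?M)" and onto: "f ` univ ?M = univ ?N"
    using iso by (auto simp: is_iso_def bij_betw_def)
  have rel: "rel ?M R u v \<longleftrightarrow> rel ?N R (f u) (f v)" if "u \<in> univ ?M" "v \<in> univ ?M" for R u v
    using iso that unfolding is_iso_def by blast
  have Inl_mem: "Inl z \<in> univ ?M" if "z \<in> univ S" for z
    using that by (auto simp: univ_composite_tag)
  have Inr_mem: "Inr (z, c) \<in> univ ?M" if "z \<in> univ S" "c \<in> univ (P z)" for z c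
    using that by (auto simp: univ_composite_tag)
  have "\<exists>y\<in>univ S. f (Inl z) = Inl y" if z: "z \<in> univ S" for z
  proof -
    have "rel ?N Member (f (Inl z)) (f (Inl z))"
      using rel[OF Inl_mem[OF z] Inl_mem[OF z], of Member] z by (simp add: composite_tag_Member)
    then show ?thesis by (cases "f (Inl z)") (auto simp: composite_tag_Member)
  qed
  then obtain h where h: "z \<in> univ S \<Longrightarrow> h z \<in> univ S" "z \<in> univ S \<Longrightarrow> f (Inl z) = Inl (h z)" for z
    by metis
  have "\<exists>d\<in>univ (Q (h z)). f (Inr (z, c)) = Inr (h z, d)"
    if z: "z \<in> univ S" and c: "c \<in> univ (P z)" for z c
  proof -
    have "rel ?N Member (f (Inr (z, c))) (Inl (h z))"
      using rel[OF Inr_mem[OF z c] Inl_mem[OF z], of Member] z c h(2)[OF z]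
      by (simp add: composite_tag_Member)
    \<comment> \<open>Otherwise \<open>f\<close> would identify this element with
      \<open>Inl z\<close>.\<close>
    moreover have "f (Inr (z, c)) \<noteq> Inl (h z)"
      using inj_onD[OF inj, of "Inr (z, c)" "Inl z"] Inr_mem[OF z c] Inl_mem[OF z] h(2)[OF z] by auto
    ultimately show ?thesis by (auto simp: composite_tag_Member)
  qed
  then obtain \<phi> where \<phi>: "z \<in> univ S \<Longrightarrow> c \<in> univ (P z) \<Longrightarrow> \<phi> z c \<in> univ (Q (h z))"
      "z \<in> univ S \<Longrightarrow> c \<in> univ (P z) \<Longrightarrow> f (Inr (z, c)) = Inr (h z, \<phi> z c)" for z c
    by metis
  have "is_iso (\<phi> z) (P z) (Q (h z))" if z: "z \<in> univ S" for z
  proof -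
    have "inj_on (\<phi> z) (univ (P z))"
    proof (rule inj_onI)
      fix c d assume "c \<in> univ (P z)" "d \<in> univ (P z)" "\<phi> z c = \<phi> z d"
      then show "c = d"
        using inj_onD[OF inj, of "Inr (z, c)" "Inr (z, d)"] \<phi>(2)[OF z] Inr_mem[OF z] by auto
    qed
    moreover have "d \<in> \<phi> z ` univ (P z)" if d: "d \<in> univ (Q (h z))" for d
    proof -
      have "Inr (h z, d) \<in> f ` univ ?M"
        unfolding onto using d h(1)[OF z] by (auto simp: univ_composite_tag)
      then obtain u where u: "u \<in> univ ?M" "f u = Inr (h z, d)" by (elim imageE) simp
      \<comment> \<open>The preimage \<open>u\<close> is related to \<open>Inl z\<close> by
        \<open>Member\<close> and is not \<open>Inl z\<close> itself, whose image is an outer point;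
        so it lies in the fibre over \<open>z\<close>.\<close>
      have "rel ?M Member u (Inl z)"
        using rel[OF u(1) Inl_mem[OF z], of Member] u(2) h[OF z] d by (simp add: composite_tag_Member)
      then obtain c where "c \<in> univ (P z)" "u = Inr (z, c)"
        using u(2) h(2)[OF z] by (auto simp: composite_tag_Member)
      then show ?thesis using u(2) \<phi>(2)[OF z] by auto
    qed
    moreover have "rel (P z) R c d \<longleftrightarrow> rel (Q (h z)) R (\<phi> z c) (\<phi> z d)"
      if "c \<in> univ (P z)" "d \<in> univ (P z)" for R c d
      using rel[OF Inr_mem[OF z that(1)] Inr_mem[OF z that(2)], of "Inner R"] that z h(1)[OF z] \<phi>[OF z]
      by (simp add: composite_tag_Inner)
    moreover have "\<phi> z ` univ (P z) \<subseteq> univ (Q (h z))" using \<phi>(1)[OF z] by blast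
    ultimately show ?thesis unfolding is_iso_def bij_betw_def by blast
  qed
  moreover have "rel S R y z \<longleftrightarrow> rel S R (h y) (h z)" if "y \<in> univ S" "z \<in> univ S" for R y z
    using rel[OF Inl_mem[OF that(1)] Inl_mem[OF that(2)], of "Outer R"] that h
    by (simp add: composite_tag_Outer)
  ultimately show thesis by (intro that[of h \<phi>] h(1) \<phi>(2))
qed

fun composite_map :: "('s \<Rightarrow> 's) \<Rightarrow> ('s \<Rightarrow> 'c \<Rightarrow> 'c) \<Rightarrow> 's + 's \<times> 'c \<Rightarrow> 's + 's \<times> 'c" where
  "composite_map h \<phi> (Inl z) = Inl (h z)"
| "composite_map h \<phi> (Inr (z, c)) = Inr (h z, \<phi> z c)"

text \<open>\<open>Member\<close> sees only the index of a fibre, \<open>Outer\<close> only outer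
  points, and \<open>Inner\<close> holds only within one fibre, so the pieces glue without
  interacting.\<close>

lemma composite_tag_iso_intro:
  assumes h: "is_iso h S S" and \<phi>: "\<And>z. z \<in> univ S \<Longrightarrow> is_iso (\<phi> z) (P z) (Q (h z))"
  shows "is_iso (composite_map h \<phi>)
    (composite S (\<lambda>z. tag z (P z))) (composite S (\<lambda>z. tag z (Q z)))"
    (is "is_iso ?f ?M ?N")
proof -
  have h_bij: "bij_betw h (univ S) (univ S)"
    and h_rel: "\<And>R y z. y \<in> univ S \<Longrightarrow> z \<in> univ S \<Longrightarrow> rel S R (h y) (h z) \<longleftrightarrow> rel S R y z"
    using h by (auto simp: is_iso_def)
  have h_mem: "h z \<in> univ S" if "z \<in> univ S" for z using bij_betwE[OF h_bij] that by blast
  have h_eq: "h y = h z \<longleftrightarrow> y = z" if "y \<in> univ S" "z \<in> univ S" for y z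
    using h_bij that by (auto simp: bij_betw_def inj_on_def)
  have \<phi>_bij: "bij_betw (\<phi> z) (univ (P z)) (univ (Q (h z)))"
    and \<phi>_rel: "\<And>R c d. c \<in> univ (P z) \<Longrightarrow> d \<in> univ (P z) \<Longrightarrow>
      rel (Q (h z)) R (\<phi> z c) (\<phi> z d) \<longleftrightarrow> rel (P z) R c d" if "z \<in> univ S" for z
    using \<phi>[OF that] by (auto simp: is_iso_def)
  have \<phi>_mem: "\<phi> z c \<in> univ (Q (h z))" if "z \<in> univ S" "c \<in> univ (P z)" for z c
    using bij_betwE[OF \<phi>_bij] that by blast
  have \<phi>_eq: "\<phi> z c = \<phi> z d \<longleftrightarrow> c = d"
    if "z \<in> univ S" "c \<in> univ (P z)" "d \<in> univ (P z)" for z c d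
    using \<phi>_bij that by (auto simp: bij_betw_def inj_on_def)
  have bij: "bij_betw ?f (univ ?M) (univ ?N)"
  proof (rule bij_betwI')
    fix u v assume "u \<in> univ ?M" "v \<in> univ ?M"
    then show "?f u = ?f v \<longleftrightarrow> u = v"
      by (auto simp: univ_composite_tag h_eq \<phi>_eq)
  next
    fix u assume "u \<in> univ ?M"
    then show "?f u \<in> univ ?N" by (auto simp: univ_composite_tag h_mem \<phi>_mem)
  next
    fix v assume "v \<in> univ ?N"
    then consider y where "y \<in> univ S" "v = Inl y"
      | y d where "y \<in> univ S" "d \<in> univ (Q y)" "v = Inr (y, d)"
      by (auto simp: univ_composite_tag)
    then show "\<exists>u\<in>univ ?M. v = ?f u"
    proof cases
      case 1
      then obtain z where "z \<in> univ S" "h z = y" using h_bij by (metis bij_betw_iff_bijections)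
      with 1 show ?thesis by (intro bexI[of _ "Inl z"]) (auto simp: univ_composite_tag)
    next
      case 2
      then obtain z where z: "z \<in> univ S" "h z = y" using h_bij by (metis bij_betw_iff_bijections)
      then obtain c where "c \<in> univ (P z)" "\<phi> z c = d"
        using \<phi>_bij[OF z(1)] 2 by (metis bij_betw_iff_bijections)
      with 2 z show ?thesis by (intro bexI[of _ "Inr (z, c)"]) (auto simp: univ_composite_tag)
    qed
  qed
  have "rel ?M R u v \<longleftrightarrow> rel ?N R (?f u) (?f v)" if "u \<in> univ ?M" "v \<in> univ ?M" for R u v
    using that
    by (cases R)
      (auto simp: univ_composite_tag composite_tag_Member composite_tag_Outer composite_tag_Inner
        h_rel h_mem h_eq \<phi>_rel \<phi>_mem \<phi>_eq)
  with bij show ?thesis unfolding is_iso_def by blast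
qed

section \<open>The isomorphism spectrum\<close>

text \<open>The components before tagging; with them both structures take the form
  \<open>composite S (\<lambda>z. tag z (P z))\<close> treated above.\<close>

definition Mfibre where
  "Mfibre A B z = (case z of Fin X \<Rightarrow> if even (card X) then A 0 else B 0
    | Pt i a \<Rightarrow> if a then B (i + 1) else A (i + 1))"

definition Nfibre where
  "Nfibre A B z = (case z of Fin X \<Rightarrow> if even (card X) then B 0 else A 0
    | Pt i a \<Rightarrow> if a then B (i + 1) else A (i + 1))"

lemma Mstruct_eq: "Mstruct A B = composite Hstruct (\<lambda>z. tag z (Mfibre A B z))"
proof -
  have "Mcomp A B z = tag z (Mfibre A B z)" for z
    by (cases "(A, B, z)" rule: Mcomp.cases) (auto simp: Mfibre_def)
  then have "Mcomp A B = (\<lambda>z. tag z (Mfibre A B z))" by blast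
  then show ?thesis by (simp only: Mstruct_def)
qed

lemma Nstruct_eq: "Nstruct A B = composite Hstruct (\<lambda>z. tag z (Nfibre A B z))"
proof -
  have "Ncomp A B z = tag z (Nfibre A B z)" for z
    by (cases "(A, B, z)" rule: Ncomp.cases) (auto simp: Nfibre_def)
  then have "Ncomp A B = (\<lambda>z. tag z (Nfibre A B z))" by blast
  then show ?thesis by (simp only: Nstruct_def)
qed

lemma Hstruct_simps [simp]:
  "Fin X \<in> univ Hstruct \<longleftrightarrow> finite X" "Pt i a \<in> univ Hstruct" "rel Hstruct = h_rel"
  by (auto simp: Hstruct_def)

text \<open>Pairing with the fixed number \<open>j\<close> and unpairing are computable, so
  \<open>X j\<close> represents the degree of \<open>Join {j} X\<close>.\<close>

lemma Join_singleton_equiv: "Join {j} X \<le>\<^sub>T X j" "X j \<le>\<^sub>T Join {j} X"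
proof -
  have "w \<in> Join {j} X \<longleftrightarrow> fst (prod_decode w) = j \<and> snd (prod_decode w) \<in> X j" for w
    by (auto simp: Join_def) (metis prod.collapse prod_decode_inverse)
  then show "Join {j} X \<le>\<^sub>T X j"
    unfolding turing_le_iff_recursive by simp (intro recursive_in_intros; simp)
  have "n \<in> X j \<longleftrightarrow> prod_encode (j, n) \<in> Join {j} X" for n
    by (auto simp: Join_def)
  then show "X j \<le>\<^sub>T Join {j} X"
    unfolding turing_le_iff_recursive by simp (intro recursive_in_intros; simp)
qed

text \<open>The numbering is onto, so the machine converges on every number and defines a total
  function, to which the closure rules apply.\<close>

lemma computes_recursive1:
  assumes "computes d c U f" and c: "bij_betw c U UNIV"
  obtains Z F where "deg Z = d" "recursive1 Z F" "\<And>u. u \<in> U \<Longrightarrow> F (c u) = c (f u)"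
proof -
  obtain Z p where Z: "deg Z = d" and p: "\<And>u. u \<in> U \<Longrightarrow> rec_eval Z p [c u] (c (f u))"
    using assms(1) by (auto simp: computes_def)
  let ?F = "\<lambda>n. c (f (inv_into U c n))"
  have "rec_eval Z p [n] (?F n)" for n
    using p[of "inv_into U c n"] c
    by (simp add: bij_betw_def inv_into_into f_inv_into_f)
  then have "recursive1 Z ?F" unfolding recursive1_iff[of Z ?F] by blast
  moreover have "?F (c u) = c (f u)" if "u \<in> U" for u
    using that c by (simp add: bij_betw_def inv_into_f_f)
  ultimately show thesis using that[of Z ?F] Z by blast
qed

lemma mcode_simps:
  "mcode (Inl z) = 2 * hcode z"
  "mcode (Inr (z, n)) = Suc (2 * prod_encode (hcode z, n))"
  "hcode (Fin X) = 2 * set_encode X"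
  "hcode (Pt i a) = Suc (2 * (2 * i + of_bool a))"
  by (simp_all add: sum_encode_def)

declare mcode.simps [simp del] hcode.simps [simp del]

section \<open>Lower bounds for the members of the spectrum\<close>

lemma IsoSpec_lower_bound:
  assumes A: "\<And>n. A n = omega" and B: "\<And>n. B n = omega_ce (x n)" and x: "\<And>n. range (x n) = X n"
    and d: "d \<in> IsoSpec mcode (Mstruct A B) (Nstruct A B)"
  obtains j where "deg (Join {j} X) \<le> d"
proof -
  obtain f where iso: "is_iso f (Mstruct A B) (Nstruct A B)"
    and comp: "computes d mcode (univ (Mstruct A B)) f"
    using d by (auto simp: IsoSpec_def)
  have AB: "univ (A n) = UNIV" "univ (B n) = UNIV" for n
    by (simp_all add: A B omega_def omega_ce_def)
  obtain Z F where Z: "deg Z = d" and F: "recursive1 Z F"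
    and F_eq: "\<And>u. u \<in> univ (Mstruct A B) \<Longrightarrow> F (mcode u) = mcode (f u)"
    using computes_recursive1[OF comp bij_mcode(1)[OF AB]] by blast
  obtain h \<phi> where h_mem: "\<And>z. z \<in> univ Hstruct \<Longrightarrow> h z \<in> univ Hstruct"
    and h_rel: "\<And>R y z. y \<in> univ Hstruct \<Longrightarrow> z \<in> univ Hstruct \<Longrightarrow>
      rel Hstruct R y z \<longleftrightarrow> rel Hstruct R (h y) (h z)"
    and \<phi>: "\<And>z. z \<in> univ Hstruct \<Longrightarrow> is_iso (\<phi> z) (Mfibre A B z) (Nfibre A B (h z))"
    and f_eq: "\<And>z c. z \<in> univ Hstruct \<Longrightarrow> c \<in> univ (Mfibre A B z) \<Longrightarrow>
      f (Inr (z, c)) = Inr (h z, \<phi> z c)"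
    using composite_tag_iso_elim[OF iso[unfolded Mstruct_eq Nstruct_eq]] by blast
  have bound: "deg (Join {j} X) \<le> d"
    if z: "z \<in> univ Hstruct" and M: "Mfibre A B z = A j" and N: "Nfibre A B (h z) = B j" for z j
  proof -
    \<comment> \<open>Halving the code of the image and taking the second component strips off
      \<open>h z\<close> and leaves the fibre map on numbers.\<close>
    have "\<phi> z n = snd (prod_decode (F (Suc (2 * prod_encode (hcode z, n))) div 2))" for n
    proof -
      have "Inr (z, n) \<in> univ (Mstruct A B)" "f (Inr (z, n)) = Inr (h z, \<phi> z n)"
        using z f_eq[OF z] by (auto simp: Mstruct_eq univ_composite_tag M AB)
      then show ?thesis using F_eq[of "Inr (z, n)"] by (simp add: mcode_simps)
    qed
    moreover have "recursive1 Z
        (\<lambda>n. snd (prod_decode (F (Suc (2 * prod_encode (hcode z, n))) div 2)))"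
      by (intro recursive_in_intros recursive_in_comp1[OF F]) simp
    ultimately have "recursive1 Z (\<phi> z)" by simp
    moreover have "is_iso (\<phi> z) omega (omega_ce (x j))"
      using \<phi>[OF z] by (simp add: M N A B)
    ultimately have "X j \<le>\<^sub>T Z" using turing_le_of_iso_omega_ce x by metis
    then show ?thesis
      using Z deg_le_iff turing_le_trans[OF Join_singleton_equiv(1)] by metis
  qed
  \<comment> \<open>\<open>E 0\<close> holds only between finite sets, so the image of the empty set
    is again one, called \<open>G\<close>.\<close>
  have E: "h_rel (E 0) (h (Fin {})) (h (Fin {0}))"
    using h_rel[of "Fin {}" "Fin {0}" "E 0"] by simp
  then obtain G where G: "h (Fin {}) = Fin G"
    by (cases "h (Fin {})"; cases "h (Fin {0})") auto
  show thesis
  proof (cases "G = {}")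
    case True
    \<comment> \<open>The empty set has even size, so its fibre is \<open>A 0\<close> in the source
      and \<open>B 0\<close> in the target.\<close>
    with G have "deg (Join {0} X) \<le> d"
      by (intro bound[of "Fin {}"]) (auto simp: Mfibre_def Nfibre_def)
    then show thesis by (rule that)
  next
    case False
    then obtain i where i: "i \<in> G" by blast
    \<comment> \<open>\<open>D i\<close> records that \<open>i\<close> is not in the empty set. As
      \<open>i\<close> lies in the image \<open>G\<close>, the point must change its truth value,
      and its fibre \<open>A (i + 1)\<close> goes to \<open>B (i + 1)\<close>.\<close>
    have "h_rel (D i) (Fin G) (h (Pt i False))"
      using h_rel[of "Fin {}" "Pt i False" "D i"] G by simp
    with i have "h (Pt i False) = Pt i True" by (cases "h (Pt i False)") auto
    then have "deg (Join {i + 1} X) \<le> d"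
      by (intro bound[of "Pt i False"]) (auto simp: Mfibre_def Nfibre_def)
    then show thesis by (rule that)
  qed
qed

section \<open>The automorphism toggling one number, and its computability\<close>

definition toggle :: "nat \<Rightarrow> nat set \<Rightarrow> nat set" where
  "toggle i X = (if i \<in> X then X - {i} else insert i X)"

lemma toggle_toggle [simp]: "toggle i (toggle i X) = X"
  by (auto simp: toggle_def)

lemma finite_toggle [simp]: "finite (toggle i X) \<longleftrightarrow> finite X"
  by (simp add: toggle_def)

text \<open>The two symmetric differences with \<open>{i}\<close> cancel; hence the relations
  \<open>E\<close> are preserved.\<close>

lemma toggle_symm_diff:
  "(toggle i X - toggle i Y) \<union> (toggle i Y - toggle i X) = (X - Y) \<union> (Y - X)"
  by (auto simp: toggle_def)

text \<open>Because of the change of parity, the fibre over \<open>X\<close> in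
  \<open>Mstruct\<close> and the fibre over \<open>toggle i X\<close> in \<open>Nstruct\<close> are
  copies of the same order.\<close>

lemma even_card_toggle: "finite X \<Longrightarrow> even (card (toggle i X)) \<longleftrightarrow> odd (card X)"
  by (cases "i \<in> X") (auto simp: toggle_def card_Diff_singleton card_gt_0_iff even_diff_nat)

text \<open>Toggling flips binary digit \<open>i\<close> of the canonical index; that digit is the
  parity after \<open>i\<close> halvings.\<close>

lemma set_encode_toggle:
  assumes "finite X"
  shows "set_encode (toggle i X) =
    (if odd (set_encode X div 2 ^ i) then set_encode X - 2 ^ i else set_encode X + 2 ^ i)"
proof -
  have "odd (set_encode X div 2 ^ i) \<longleftrightarrow> i \<in> X"
    using set_encode_inverse[OF assms] by (auto simp: set_decode_def)
  moreover have "set_encode X = 2 ^ i + set_encode (X - {i})" if "i \<in> X"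
    using set_encode_insert[of "X - {i}" i] assms that by (simp add: insert_absorb)
  ultimately show ?thesis using assms by (simp add: toggle_def)
qed

text \<open>The automorphism for \<open>G = {i}\<close>. Preserving \<open>D i\<close> forces the
  two points \<open>Pt i False\<close> and \<open>Pt i True\<close> to be exchanged.\<close>

fun flip :: "nat \<Rightarrow> hpoint \<Rightarrow> hpoint" where
  "flip i (Fin X) = Fin (toggle i X)"
| "flip i (Pt j a) = Pt j (if j = i then \<not> a else a)"

lemma is_iso_flip: "is_iso (flip i) Hstruct Hstruct"
  unfolding is_iso_def
proof (intro conjI allI ballI)
  have "flip i (flip i z) = z" for z by (cases z) simp_all
  moreover have "flip i z \<in> univ Hstruct" if "z \<in> univ Hstruct" for z
    using that by (cases z) simp_all
  ultimately show "bij_betw (flip i) (univ Hstruct) (univ Hstruct)"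
    by (intro bij_betw_byWitness[where f' = "flip i"]) auto
  fix R y z
  show "rel Hstruct R y z \<longleftrightarrow> rel Hstruct R (flip i y) (flip i z)"
    by (cases "(R, y, z)" rule: h_rel.cases)
      (auto simp: toggle_symm_diff, auto simp: toggle_def split: if_splits)
qed

lemma recursive1_flip:
  obtains K where "recursive1 Z K" "\<And>z. z \<in> univ Hstruct \<Longrightarrow> K (hcode z) = hcode (flip i z)"
proof -
  define T where "T n = (if \<not> even (n div 2 ^ i) then n - 2 ^ i else n + 2 ^ i)" for n :: nat
  \<comment> \<open>Even codes are those of finite sets. An odd code halves to twice the index of
    the point plus its truth value; the last digit is switched if the index is
    \<open>i\<close>.\<close>
  define K where "K a = (if even a then 2 * T (a div 2)
    else if a div 2 div 2 = i then Suc (2 * (if even (a div 2) then Suc (a div 2) else a div 2 - 1))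
    else a)" for a :: nat
  have T: "recursive1 Z T"
    unfolding T_def by (intro recursive_in_intros) simp_all
  have "recursive1 Z K"
    unfolding K_def by (intro recursive_in_intros recursive_in_comp1[OF T]) simp_all
  moreover have "K (hcode z) = hcode (flip i z)" if "z \<in> univ Hstruct" for z
    using that by (cases z) (auto simp: K_def T_def mcode_simps set_encode_toggle)
  ultimately show thesis using that by blast
qed

text \<open>There are infinitely many fibres, so their maps must be given by one recursive function
  \<open>N\<close> of the code of the fibre and the element.\<close>

lemma computes_composite_map:
  assumes K: "recursive1 Z K" "\<And>z. z \<in> univ Hstruct \<Longrightarrow> K (hcode z) = hcode (h z)"
    and N: "recursive2 Z N" "\<And>z n. z \<in> univ Hstruct \<Longrightarrow> N (hcode z) n = \<phi> z n"
  shows "computes (deg Z) mcode (univ (composite Hstruct (\<lambda>z. tag z (P z)))) (composite_map h \<phi>)"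
proof -
  define F where "F v = (if even v then 2 * K (v div 2)
    else Suc (2 * prod_encode (K (fst (prod_decode (v div 2))),
      N (fst (prod_decode (v div 2))) (snd (prod_decode (v div 2))))))" for v
  have "recursive1 Z F"
    unfolding F_def
    by (intro recursive_in_intros recursive_in_comp1[OF K(1)] recursive_in_comp2[OF N(1)]) simp_all
  then obtain p where p: "\<And>n. rec_eval Z p [n] (F n)"
    unfolding recursive1_iff[of Z F] by blast
  have "F (mcode u) = mcode (composite_map h \<phi> u)"
    if "u \<in> univ (composite Hstruct (\<lambda>z. tag z (P z)))" for u
    using that by (auto simp: univ_composite_tag F_def mcode_simps K(2) N(2))
  then show ?thesis unfolding computes_def using p by metis
qed

lemma is_iso_id: "is_iso id S S"
  by (simp add: is_iso_def)

lemma deg_in_IsoSpec: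
  assumes A: "\<And>n. A n = omega" and B: "\<And>n. B n = omega_ce (x n)"
    and inj: "inj (x (i + 1))" and X: "range (x (i + 1)) \<le>\<^sub>T Z" and x: "recursive1 Z (x (i + 1))"
  shows "deg Z \<in> IsoSpec mcode (Mstruct A B) (Nstruct A B)"
proof -
  let ?r = "ce_rank (x (i + 1))"
  \<comment> \<open>Over \<open>Pt i False\<close> the map leads from \<open>omega\<close> to
    \<open>omega_ce (x (i + 1))\<close>, over \<open>Pt i True\<close> back; every other fibre meets
    an equal order, so the identity serves.\<close>
  define \<phi> where "\<phi> z = (if z = Pt i False then inv ?r else if z = Pt i True then ?r else id)" for z
  have "is_iso (\<phi> z) (Mfibre A B z) (Nfibre A B (flip i z))" if "z \<in> univ Hstruct" for z
    using that is_iso_omega_ce[OF inj]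
    by (cases z) (auto simp: \<phi>_def Mfibre_def Nfibre_def even_card_toggle is_iso_id A B)
  then have iso: "is_iso (composite_map (flip i) \<phi>) (Mstruct A B) (Nstruct A B)"
    unfolding Mstruct_eq Nstruct_eq by (intro composite_tag_iso_intro is_iso_flip)
  obtain K where K: "recursive1 Z K" "\<And>z. z \<in> univ Hstruct \<Longrightarrow> K (hcode z) = hcode (flip i z)"
    using recursive1_flip by blast
  have r: "recursive1 Z ?r" using X x by (rule recursive1_ce_rank)
  have inv_r: "recursive1 Z (inv ?r)" using r bij_ce_rank[OF inj] by (rule recursive1_inv)
  \<comment> \<open>Only two fibre maps differ from the identity, so comparing the code with two
    constants makes the family uniform.\<close>
  define N where "N a n = (if a = hcode (Pt i False) then inv ?r n
    else if a = hcode (Pt i True) then ?r n else n)" for a n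
  have N: "recursive2 Z N"
    unfolding N_def
    by (intro recursive_in_intros recursive_in_comp1[OF r] recursive_in_comp1[OF inv_r]) simp_all
  have "hcode z = hcode w \<longleftrightarrow> z = w" if "z \<in> univ Hstruct" "w \<in> univ Hstruct" for z w
    using bij_hcode that by (auto simp: bij_betw_def inj_on_def)
  then have "N (hcode z) n = \<phi> z n" if "z \<in> univ Hstruct" for z n
    using that by (simp add: N_def \<phi>_def)
  with K N have "computes (deg Z) mcode (univ (Mstruct A B)) (composite_map (flip i) \<phi>)"
    unfolding Mstruct_eq by (intro computes_composite_map)
  with iso show ?thesis by (auto simp: IsoSpec_def)
qed

theorem theorem3p21:
  fixes X :: "nat \<Rightarrow> nat set" and x :: "nat \<Rightarrow> nat \<Rightarrow> nat"
    and A B :: "nat \<Rightarrow> (ord_sym, nat) struct"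
  assumes "uniform_ce_enumeration X x"
    and "thomason_family X"
    and "\<And>n. A n = omega"
    and "\<And>n. B n = omega_ce (x n)"
  shows "\<not> finitely_generated (IsoSpec mcode (Mstruct A B) (Nstruct A B))"
proof
  let ?D = "IsoSpec mcode (Mstruct A B) (Nstruct A B)"
  obtain p where p: "\<And>n i. rec_eval {} p [n, i] (x n i)"
    and inj: "\<And>n. inj (x n)" and X: "\<And>n. range (x n) = X n"
    using assms(1) by (auto simp: uniform_ce_enumeration_def)
  \<comment> \<open>The empty oracle reduces to every \<open>Z\<close>, so the computable
    enumerations are recursive in every \<open>Z\<close>.\<close>
  have empty: "{} \<le>\<^sub>T Z" for Z
    by (simp add: turing_le_iff_recursive recursive_in_const)
  have "recursive2 {} x" using p by (auto simp only: recursive2_iff)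
  then have "recursive1 {} (x n)" for n
    by (rule recursive_in_comp2[OF _ recursive_in_const recursive_in_arg]) simp
  then have x: "recursive1 Z (x n)" for Z n
    by (rule recursive_in_oracle_mono[OF empty])
  have mem: "deg (Join {Suc i} X) \<in> ?D" for i
    using deg_in_IsoSpec[where x = x and i = i, OF assms(3,4) inj _ x]
      Join_singleton_equiv(2)[of X "Suc i"] by (simp add: X)
  assume "finitely_generated ?D"
  then obtain G where G: "finite G" and D: "?D = (\<Union>d\<in>G. upper_cone d)"
    by (auto simp: finitely_generated_def)
  have "\<exists>g\<in>G. g \<le> deg (Join {Suc i} X)" for i
    using mem[of i] by (auto simp: D upper_cone_def)
  then obtain g where g: "\<And>i. g i \<in> G" "\<And>i. g i \<le> deg (Join {Suc i} X)" by metis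
  have "inj g"
  proof (rule injI)
    fix i j assume eq: "g i = g j"
    have "g i \<in> ?D" using g(1)[of i] by (auto simp: D upper_cone_def)
    then obtain k where k: "deg (Join {k} X) \<le> g i"
      by (rule IsoSpec_lower_bound[where A = A and B = B and x = x, OF assms(3,4) X])
    \<comment> \<open>\<open>k\<close> is found from the generator \<open>g i\<close> alone;
      inclusion of singletons then determines every index \<open>l\<close> that this generator
      serves.\<close>
    have k_eq: "k = Suc l" if "g l = g i" for l
    proof -
      have "deg (Join {k} X) \<le> deg (Join {Suc l} X)" using k g(2)[of l] that by simp
      moreover have "finite {k}" "finite {Suc l}" by simp_all
      ultimately have "{k} \<subseteq> {Suc l}" using assms(2) unfolding thomason_family_def by blast
      then show ?thesis by simp
    qed
    from k_eq[OF refl] k_eq[OF eq[symmetric]] show "i = j" by simp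
  qed
  moreover have "finite (range g)" using g(1) G by (auto intro: finite_subset[of _ G])
  ultimately show False using finite_imageD[of g UNIV] by simp
qed

end
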